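(* Let $n\ge 1$, let $\mathcal X$ be a set, let $\mathcal Y=\mathbb R$, let $D=(\boldsymbol x,\boldsymbol y)\in\mathcal X^n\times\mathbb R^n$ be data, and let $\mathcal M$ be a class of linear regressors $M:\mathcal X^n\to\mathbb R^{n\times n}$. For $M\in\mathcal M$ and $\alpha\ge 0$ put $$S_\alpha=S_\alpha(M):=(I-M(\boldsymbol x))^\top(I-M(\boldsymbol x))+\alpha I .$$ Then the best pairs $(M,\alpha)$ according to the loss rank principle, i.e. the minimizers of the regularized log loss rank $\mathrm{LR}_M^\alpha(\boldsymbol y|\boldsymbol x)$ over $M\in\mathcal M$ and $\alpha\ge 0$, are given by $$\mathop{\arg\min}_{M\in\mathcal M,\,\alpha\ge 0}\mathrm{LR}_M^\alpha(\boldsymbol y|\boldsymbol x) =\mathop{\arg\min}_{M\in\mathcal M,\,\alpha\ge 0}\Big\{\tfrac n2\log(\boldsymbol y^\top S_\alpha\boldsymbol y)-\tfrac12\log\det S_\alpha\Big\} =\mathop{\arg\min}_{M\in\mathcal M,\,\alpha\ge 0}\Big\{\frac{\boldsymbol y^\top S_\alpha\boldsymbol y}{(\det S_\alpha)^{1/n}}\Big\},$$ as an equality of (possibly empty) sets of pairs $(M,\alpha)$, where in all three expressions only pairs with $\det S_\alpha(M)\neq 0$ are considered. The best linear regressor $M^{best}$ in $\mathcal M$ for the data $D$ is the $M$-component of such a minimizing pair.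
   Context: A linear regressor is given on the training data by a matrix-valued function $M:\mathcal X^n\to\mathbb R^{n\times n}$; its predictions at the points $x_1,\dots,x_n$ of $\boldsymbol x=(x_1,\dots,x_n)$ from the values $\boldsymbol y\in\mathbb R^n$ are $\hat{\boldsymbol y}=M(\boldsymbol x)\boldsymbol y$. $I$ is the $n\times n$ identity matrix and $\|\cdot\|$ the Euclidean norm. Regularized quadratic loss: for $\alpha\ge 0$ and $\boldsymbol y'\in\mathbb R^n$, $$\mathrm{Loss}_M^\alpha(\boldsymbol y'|\boldsymbol x):=\sum_{i=1}^n\Big(y'_i-\sum_{j=1}^nM_{ij}(\boldsymbol x)y'_j\Big)^2+\alpha\|\boldsymbol y'\|^2 .$$ Log loss rank (log loss volume): $$\mathrm{LR}_M^\alpha(\boldsymbol y|\boldsymbol x):=\log\big|V_M^\alpha(L)\big|,\qquad V_M^\alpha(L):=\{\boldsymbol y'\in\mathbb R^n:\mathrm{Loss}_M^\alpha(\boldsymbol y'|\boldsymbol x)\le L\},\qquad L:=\mathrm{Loss}_M^\alpha(\boldsymbol y|\boldsymbol x),$$ where $|\cdot|$ is $n$-dimensional Lebesgue volume. Convention: $\log 0=-\infty$. The loss rank principle (LoRP) declares the best regressor to be the one minimizing the log loss rank, where the regularization parameter $\alpha$ is also determined by minimizing the log loss rank. *)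

theory Defs
  imports "HOL-Analysis.Analysis"
begin

text \<open>
  A linear regressor maps the inputs \<open>x\<close> to the matrix \<open>M x\<close> whose fitted values are \<open>M x *v y\<close>.
  The index type \<open>'n\<close> has \<open>n = CARD('n) \<ge> 1\<close> elements, and the input space is the type \<open>'x\<close>.
\<close>

type_synonym ('x, 'n) linear_regressor = "'x ^ 'n \<Rightarrow> real ^ 'n ^ 'n"

text \<open>
  Logarithm with the convention \<open>log 0 = -\<infinity>\<close>. The value at \<open>\<infinity>\<close> only matters for level sets of
  infinite volume, which do not occur when \<open>det S\<^sub>\<alpha> \<noteq> 0\<close>.
\<close>

definition elog :: "ennreal \<Rightarrow> ereal" where
  "elog v = (if v = 0 then -\<infinity> else if v = \<infinity> then \<infinity> else ereal (ln (enn2real v)))"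

definition Loss :: "('x, 'n::finite) linear_regressor \<Rightarrow> real \<Rightarrow> 'x ^ 'n \<Rightarrow> real ^ 'n \<Rightarrow> real" where
  "Loss M \<alpha> x y' =
     (\<Sum>i\<in>UNIV. (y' $ i - (\<Sum>j\<in>UNIV. M x $ i $ j * y' $ j))\<^sup>2) + \<alpha> * (norm y')\<^sup>2"

definition loss_level_set ::
    "('x, 'n::finite) linear_regressor \<Rightarrow> real \<Rightarrow> 'x ^ 'n \<Rightarrow> real \<Rightarrow> (real ^ 'n) set" where
  "loss_level_set M \<alpha> x L = {y'. Loss M \<alpha> x y' \<le> L}"

definition log_loss_rank ::
    "('x, 'n::finite) linear_regressor \<Rightarrow> real \<Rightarrow> 'x ^ 'n \<Rightarrow> real ^ 'n \<Rightarrow> ereal" where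
  "log_loss_rank M \<alpha> x y = elog (emeasure lebesgue (loss_level_set M \<alpha> x (Loss M \<alpha> x y)))"

definition S_mat :: "('x, 'n::finite) linear_regressor \<Rightarrow> real \<Rightarrow> 'x ^ 'n \<Rightarrow> real ^ 'n ^ 'n" where
  "S_mat M \<alpha> x = transpose (mat 1 - M x) ** (mat 1 - M x) + \<alpha> *\<^sub>R mat 1"

definition admissible_pairs ::
    "('x, 'n::finite) linear_regressor set \<Rightarrow> 'x ^ 'n \<Rightarrow> (('x, 'n) linear_regressor \<times> real) set" where
  "admissible_pairs \<M> x = {(M, \<alpha>). M \<in> \<M> \<and> 0 \<le> \<alpha> \<and> det (S_mat M \<alpha> x) \<noteq> 0}"

definition argmin_set :: "'a set \<Rightarrow> ('a \<Rightarrow> 'b::linorder) \<Rightarrow> 'a set" where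
  "argmin_set A f = {p. is_arg_min f (\<lambda>q. q \<in> A) p}"

text \<open>The regularization parameter is chosen by minimizing the log loss rank, jointly with \<open>M\<close>.\<close>

definition best_regressors ::
    "('x, 'n::finite) linear_regressor set \<Rightarrow> 'x ^ 'n \<Rightarrow> real ^ 'n \<Rightarrow> ('x, 'n) linear_regressor set" where
  "best_regressors \<M> x y =
     {M. \<exists>\<alpha>. (M, \<alpha>) \<in> argmin_set (admissible_pairs \<M> x) (\<lambda>(M, \<alpha>). log_loss_rank M \<alpha> x y)}"

end

theory Submission
  imports Defs
begin

text \<open>
  Since \<open>Loss M \<alpha> x y' = y' \<bullet> S y'\<close> with \<open>S = S_mat M \<alpha> x\<close> positive definite, the level set of
  level \<open>L\<close> is an ellipsoid of volume \<open>c * sqrt L ^ n / sqrt (det S)\<close>, where \<open>c\<close> is the volume of the unit ball.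
  Hence the log loss rank exceeds the second objective by the constant \<open>ln c\<close>, and the second
  objective is \<open>n/2\<close> times the logarithm of the third. For \<open>y = 0\<close> all three objectives are constant.
  The volume is computed from a square factor \<open>B\<close> with \<open>B\<^sup>T B = S\<close>, obtained without the spectral
  theorem: the form of \<open>S\<close> is \<open>T u \<bullet> T v\<close> for the injective map \<open>T v = ((I - M x) v, sqrt \<alpha> v)\<close> into
  \<open>\<real>\<^sup>n \<times> \<real>\<^sup>n\<close>, and the range of \<open>T\<close> is isometric to \<open>\<real>\<^sup>n\<close>.
\<close>

section \<open>Linear images and the volume of ellipsoids\<close>

text \<open>
  The library's \<open>measure_linear_image\<close> needs a wellordered index type. Its order only serves to compute the
  determinant of a shear, which here comes from \<open>det_row_operation\<close>.
\<close>

lemma linear_image_lebesgue: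
  fixes f :: "real^'n::finite \<Rightarrow> real^'n"
  assumes "linear f" "S \<in> lmeasurable"
  shows "f ` S \<in> lmeasurable \<and> measure lebesgue (f ` S) = \<bar>det (matrix f)\<bar> * measure lebesgue S"
proof -
  \<comment> \<open>The set is quantified inside \<open>?P\<close> because the composition step
    applies the claim for \<open>f\<close> to images under \<open>g\<close>.\<close>
  let ?P = "\<lambda>f::real^'n \<Rightarrow> real^'n. \<forall>S\<in>lmeasurable. f ` S \<in> lmeasurable \<and>
    measure lebesgue (f ` S) = \<bar>det (matrix f)\<bar> * measure lebesgue S"
  have "?P f"
  proof (rule induct_linear_elementary[OF assms(1)])
    fix f g :: "real^'n \<Rightarrow> real^'n"
    assume "linear f" "linear g" "?P f" "?P g"
    then show "?P (f \<circ> g)"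
      by (simp add: matrix_compose det_mul abs_mult del: o_apply flip: image_comp)
  next
    fix f :: "real^'n \<Rightarrow> real^'n" and i
    assume "linear f" and zero: "\<And>x. f x $ i = 0"
    \<comment> \<open>The range lies in a coordinate hyperplane, so both sides of the claim
      vanish.\<close>
    have "\<not> surj f"
      using zero by (metis one_neq_zero surjD vec_component)
    then have "\<not> inj f"
      using \<open>linear f\<close> linear_injective_imp_surjective by blast
    then have "negligible (f ` S)" "det (matrix f) = 0" for S
      using \<open>linear f\<close> negligible_linear_singular_image det_nz_iff_inj by blast+
    then show "?P f"
      by (simp add: negligible_iff_measure)
  next
    fix c :: "'n \<Rightarrow> real"
    have "matrix (\<lambda>x::real^'n. \<chi> i. c i * x $ i) = (\<chi> i j. if i = j then c i else 0)"
      by (simp add: matrix_def axis_def vec_eq_iff)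
    then show "?P (\<lambda>x. \<chi> i. c i * x $ i)"
      by (simp add: measurable_stretch measure_stretch det_diagonal)
  next
    fix m n :: 'n
    let ?p = "Transposition.transpose m n"
    let ?h = "\<lambda>x::real^'n. \<chi> i. x $ ?p i"
    have lin: "linear ?h"
      by (rule linearI) (simp_all add: vec_eq_iff)
    have perm: "?p permutes UNIV"
      by (rule permutes_swap_id) auto
    have "matrix ?h = (\<chi> i. mat 1 $ ?p i)"
      by (simp add: matrix_def axis_def mat_def vec_eq_iff)
    then have det: "\<bar>det (matrix ?h)\<bar> = 1"
      by (simp add: det_permute_rows perm sign_def)
    have hh: "?h (?h x) = x" for x
      by (simp add: vec_eq_iff)
    have box: "?h x \<in> cbox (?h a) (?h b) \<longleftrightarrow> x \<in> cbox a b" for x a b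
      unfolding mem_box_cart vec_lambda_beta by (metis transpose_involutory)
    have im: "?h ` cbox a b = cbox (?h a) (?h b)" for a b
    proof
      show "?h ` cbox a b \<subseteq> cbox (?h a) (?h b)"
        using box by blast
      show "cbox (?h a) (?h b) \<subseteq> ?h ` cbox a b"
      proof
        fix z assume "z \<in> cbox (?h a) (?h b)"
        then have "?h z \<in> cbox a b"
          using box[of "?h z" a b] by (simp only: hh)
        then show "z \<in> ?h ` cbox a b"
          by (intro image_eqI[where x = "?h z"]) (simp_all only: hh)
      qed
    qed
    \<comment> \<open>\<open>measure_linear_sufficient\<close> extends a scaling factor from boxes
      to measurable sets; the factor \<open>1\<close> is written out to match its premise.\<close>
    have "measure lebesgue (?h ` cbox a b) = 1 * measure lebesgue (cbox a b)" for a b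
    proof (cases "cbox a b = {}")
      case False
      then have "cbox (?h a) (?h b) \<noteq> {}"
        using im by blast
      then have "measure lebesgue (cbox (?h a) (?h b)) = (\<Prod>i\<in>UNIV. (b - a) $ ?p i)"
        by (simp add: content_cbox_if_cart)
      also have "\<dots> = (\<Prod>i\<in>UNIV. (b - a) $ i)"
        by (rule prod.reindex_bij_betw[OF permutes_imp_bij[OF perm]])
      also have "\<dots> = measure lebesgue (cbox a b)"
        using False by (simp add: content_cbox_if_cart)
      finally show ?thesis
        by (simp only: im mult_1)
    qed (simp only: image_empty measure_empty mult_1)
    note img = measure_linear_sufficient[OF lin _ this]
    show "?P ?h"
      unfolding det mult_1
      by (intro ballI conjI img[THEN conjunct1] img[THEN conjunct2, symmetric, unfolded mult_1])
  next
    fix m n :: 'n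
    assume "m \<noteq> n"
    let ?h = "\<lambda>x::real^'n. \<chi> i. if i = m then x $ m + x $ n else x $ i"
    have lin: "linear ?h"
      by (rule linearI) (auto simp: vec_eq_iff algebra_simps)
    have "matrix ?h = (\<chi> k. if k = m then row m (mat 1) + 1 *s row n (mat 1) else row k (mat 1))"
      by (auto simp: matrix_def axis_def mat_def row_def vec_eq_iff)
    then have det: "\<bar>det (matrix ?h)\<bar> = 1"
      by (simp only: det_row_operation[OF \<open>m \<noteq> n\<close>] det_I abs_one)
    have "measure lebesgue (?h ` cbox a b) = 1 * measure lebesgue (cbox a b)" for a b
    proof (cases "cbox a b = {}")
      case False
      \<comment> \<open>\<open>measure_shear_interval\<close> requires a nonnegative \<open>n\<close>-th coordinate of the lower corner.\<close>
      define v where "v = axis n (a $ n)"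
      have shift: "cbox a b = (+) v ` cbox (a - v) (b - v)"
        by (simp add: cbox_translation[symmetric])
      have "?h ` cbox a b = (+) (?h v) ` ?h ` cbox (a - v) (b - v)"
        unfolding shift image_image linear_add[OF lin] ..
      then have "measure lebesgue (?h ` cbox a b) = measure lebesgue (?h ` cbox (a - v) (b - v))"
        by (simp only: measure_translation)
      also have "\<dots> = measure lebesgue (cbox (a - v) (b - v))"
        using False shift by (intro measure_shear_interval[OF \<open>m \<noteq> n\<close>]) (auto simp: v_def)
      also have "\<dots> = measure lebesgue (cbox a b)"
        by (simp only: shift measure_translation)
      finally show ?thesis by simp
    qed simp
    note img = measure_linear_sufficient[OF lin _ this]
    show "?P ?h"
      unfolding det mult_1
      by (intro ballI conjI img[THEN conjunct1] img[THEN conjunct2, symmetric, unfolded mult_1])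
  qed
  with assms(2) show ?thesis
    by blast
qed

text \<open>The set is the preimage of the ball of radius \<open>sqrt L\<close> under
  \<open>B\<close>, hence the image of that ball under the inverse matrix.\<close>

lemma measure_ellipsoid:
  fixes B :: "real^'n::finite^'n"
  assumes "det B \<noteq> 0" "0 \<le> L"
  shows "{y. (norm (B *v y))\<^sup>2 \<le> L} \<in> lmeasurable"
    and "measure lebesgue {y. (norm (B *v y))\<^sup>2 \<le> L}
         = unit_ball_vol (real CARD('n)) * sqrt L ^ CARD('n) / \<bar>det B\<bar>"
proof -
  obtain C where BC: "B ** C = mat 1" and CB: "C ** B = mat 1"
    using assms(1) by (auto simp: invertible_det_nz[symmetric] invertible_def)
  have inv: "B *v (C *v z) = z" "C *v (B *v z) = z" for z
    by (simp_all add: matrix_vector_mul_assoc BC CB)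
  have "(norm (B *v y))\<^sup>2 \<le> L \<longleftrightarrow> B *v y \<in> cball 0 (sqrt L)" for y
    using real_sqrt_le_iff[of "(norm (B *v y))\<^sup>2" L] by simp
  then have eq: "{y. (norm (B *v y))\<^sup>2 \<le> L} = (*v) C ` cball 0 (sqrt L)"
    using inv by (auto intro!: image_eqI[where x = "B *v _"])
  have "det B * det C = 1"
    by (metis BC det_mul det_I)
  then have "\<bar>det C\<bar> = 1 / \<bar>det B\<bar>"
    using assms(1) by (metis abs_mult abs_one nonzero_eq_divide_eq abs_zero abs_eq_0 mult.commute)
  moreover have "measure lebesgue (cball (0::real^'n) (sqrt L)) = unit_ball_vol (real CARD('n)) * sqrt L ^ CARD('n)"
    using content_cball[of "sqrt L" "0::real^'n"] \<open>0 \<le> L\<close> by simp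
  moreover note linear_image_lebesgue[OF matrix_vector_mul_linear[of C] lmeasurable_cball[of 0 "sqrt L"]]
  ultimately show "{y. (norm (B *v y))\<^sup>2 \<le> L} \<in> lmeasurable"
    and "measure lebesgue {y. (norm (B *v y))\<^sup>2 \<le> L}
         = unit_ball_vol (real CARD('n)) * sqrt L ^ CARD('n) / \<bar>det B\<bar>"
    by (simp_all add: eq)
qed

section \<open>The loss as a quadratic form and its factorization\<close>

text \<open>Injectivity gives the range of \<open>T\<close> the dimension of the domain, so a linear
  isometry carries the range back to the domain; \<open>B\<close> is \<open>T\<close> followed by
  it.\<close>

lemma linear_inj_compress:
  fixes T :: "'a::euclidean_space \<Rightarrow> 'b::euclidean_space"
  assumes "linear T" "inj T"
  obtains B :: "'a \<Rightarrow> 'a" where "linear B" "\<And>u v. B u \<bullet> B v = T u \<bullet> T v"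
proof -
  have "dim (range T) = dim (UNIV :: 'a set)"
    using \<open>linear T\<close> \<open>inj T\<close> by (simp add: dim_image_eq)
  then obtain g :: "'b \<Rightarrow> 'a" where g: "linear g" "\<And>z. z \<in> range T \<Longrightarrow> norm (g z) = norm z"
    using isometries_subspaces[OF linear_subspace_image[OF \<open>linear T\<close> subspace_UNIV] subspace_UNIV]
    by metis
  have lin: "linear (g \<circ> T)"
    using g(1) \<open>linear T\<close> by (rule linear_compose[rotated])
  have "norm ((g \<circ> T) u) = norm (T u)" for u
    by (simp add: g(2))
  then have "(g \<circ> T) u \<bullet> (g \<circ> T) v = T u \<bullet> T v" for u v
    \<comment> \<open>Polarization: equal norms at \<open>u\<close>, \<open>v\<close> and
      \<open>u + v\<close> force equal inner products.\<close>
    unfolding dot_norm linear_add[OF lin, symmetric] linear_add[OF \<open>linear T\<close>, symmetric] by simp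
  with lin show thesis
    by (rule that)
qed

text \<open>Two separate vectors are allowed so that the matrix itself can be recovered from the
  form in \<open>S_mat_factorization\<close>.\<close>

lemma inner_S_mat:
  fixes M :: "('x, 'n::finite) linear_regressor"
  shows "u \<bullet> (S_mat M \<alpha> x *v v) = ((mat 1 - M x) *v u) \<bullet> ((mat 1 - M x) *v v) + \<alpha> * (u \<bullet> v)"
proof -
  have "u \<bullet> (transpose A *v w) = (A *v u) \<bullet> w" for A :: "real^'n^'n" and w
    by (metis dot_lmul_matrix inner_commute transpose_matrix_vector)
  then show ?thesis
    by (simp add: S_mat_def matrix_vector_mult_add_rdistrib scaleR_matrix_vector_assoc[symmetric]
        inner_add_right flip: matrix_vector_mul_assoc)
qed

lemma Loss_eq_inner: "Loss M \<alpha> x y = y \<bullet> (S_mat M \<alpha> x *v y)"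
proof -
  have "(\<Sum>i\<in>UNIV. (y $ i - (\<Sum>j\<in>UNIV. M x $ i $ j * y $ j))\<^sup>2) = (norm ((mat 1 - M x) *v y))\<^sup>2"
    by (simp add: power2_norm_eq_inner inner_vec_def matrix_vector_mult_diff_rdistrib
        matrix_vector_mult_def[of "M x"]) (simp add: power2_eq_square)
  then show ?thesis
    by (simp add: Loss_def inner_S_mat power2_norm_eq_inner)
qed

lemma S_mat_factorization:
  fixes M :: "('x, 'n::finite) linear_regressor"
  assumes "0 \<le> \<alpha>" "det (S_mat M \<alpha> x) \<noteq> 0"
  obtains B :: "real^'n^'n" where "S_mat M \<alpha> x = transpose B ** B"
proof -
  define T where "T v = ((mat 1 - M x) *v v, sqrt \<alpha> *\<^sub>R v)" for v
  have T: "linear T"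
    unfolding T_def by (rule linearI) (simp_all add: matrix_vector_right_distrib scaleR_add_right
        matrix_vector_mult_scaleR)
  have TT: "T u \<bullet> T v = u \<bullet> (S_mat M \<alpha> x *v v)" for u v
    using assms(1) by (simp add: T_def inner_S_mat)
  have "inj T"
    unfolding linear_injective_0[OF T]
  proof safe
    \<comment> \<open>Every \<open>u\<close> is orthogonal to
      \<open>S_mat M \<alpha> x *v v\<close>, so this vector is 0, and the nonzero determinant gives
      \<open>v = 0\<close>.\<close>
    fix v assume "T v = 0"
    then have "S_mat M \<alpha> x *v v = 0"
      using TT[of _ v] by (metis inner_zero_right vector_eq_ldot)
    then show "v = 0"
      using assms(2) by (metis invertible_det_nz invertible_def matrix_vector_mul_assoc
          matrix_vector_mul_lid matrix_vector_mult_0_right)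
  qed
  then obtain B :: "real^'n \<Rightarrow> real^'n" where B: "linear B" "\<And>u v. B u \<bullet> B v = T u \<bullet> T v"
    using linear_inj_compress[OF T] by metis
  have "(transpose (matrix B) ** matrix B) *v v = S_mat M \<alpha> x *v v" for v
  proof (subst vector_eq_ldot[symmetric], rule allI)
    fix u
    have "u \<bullet> ((transpose (matrix B) ** matrix B) *v v) = (matrix B *v u) \<bullet> (matrix B *v v)"
      by (metis dot_lmul_matrix inner_commute transpose_matrix_vector matrix_vector_mul_assoc)
    then show "u \<bullet> ((transpose (matrix B) ** matrix B) *v v) = u \<bullet> (S_mat M \<alpha> x *v v)"
      by (simp add: fun_cong[OF matrix_vector_mul(2)[OF B(1)]] B(2) TT)
  qed
  then have "S_mat M \<alpha> x = transpose (matrix B) ** matrix B"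
    by (simp add: matrix_eq)
  then show thesis
    by (rule that)
qed

text \<open>With \<open>S_mat M \<alpha> x = transpose B ** B\<close>, the determinant is the square
  of \<open>det B\<close> and the form is the squared norm of \<open>B *v z\<close>, so all three
  claims reduce to \<open>det B \<noteq> 0\<close> and \<open>measure_ellipsoid\<close>.\<close>

lemma
  fixes M :: "('x, 'n::finite) linear_regressor"
  assumes "0 \<le> \<alpha>" "det (S_mat M \<alpha> x) \<noteq> 0"
  shows det_S_mat_pos: "0 < det (S_mat M \<alpha> x)"
    and S_mat_pos_def: "y \<noteq> 0 \<Longrightarrow> 0 < y \<bullet> (S_mat M \<alpha> x *v y)"
    and emeasure_loss_level_set: "0 \<le> L \<Longrightarrow> emeasure lebesgue (loss_level_set M \<alpha> x L)
      = ennreal (unit_ball_vol (real CARD('n)) * sqrt L ^ CARD('n) / sqrt (det (S_mat M \<alpha> x)))"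
proof -
  obtain B :: "real^'n^'n" where S: "S_mat M \<alpha> x = transpose B ** B"
    using S_mat_factorization[OF assms] .
  then have det: "det (S_mat M \<alpha> x) = (det B)\<^sup>2"
    by (simp add: det_mul det_transpose power2_eq_square)
  with assms have "det B \<noteq> 0"
    by auto
  with det show "0 < det (S_mat M \<alpha> x)"
    by simp
  have quad: "z \<bullet> (S_mat M \<alpha> x *v z) = (norm (B *v z))\<^sup>2" for z
    by (metis S dot_lmul_matrix inner_commute transpose_matrix_vector matrix_vector_mul_assoc
        power2_norm_eq_inner)
  have "B *v z = 0 \<Longrightarrow> z = 0" for z
    using \<open>det B \<noteq> 0\<close> by (metis invertible_det_nz invertible_def matrix_vector_mul_assoc
          matrix_vector_mul_lid matrix_vector_mult_0_right)
  then show "y \<noteq> 0 \<Longrightarrow> 0 < y \<bullet> (S_mat M \<alpha> x *v y)"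
    by (auto simp: quad)
  assume "0 \<le> L"
  then show "emeasure lebesgue (loss_level_set M \<alpha> x L)
      = ennreal (unit_ball_vol (real CARD('n)) * sqrt L ^ CARD('n) / sqrt (det (S_mat M \<alpha> x)))"
    using measure_ellipsoid[OF \<open>det B \<noteq> 0\<close>]
    by (simp add: loss_level_set_def Loss_eq_inner quad emeasure_eq_measure2 det)
qed

section \<open>Comparison of the three objectives\<close>

lemma elog_ennreal: "0 < r \<Longrightarrow> elog (ennreal r) = ereal (ln r)"
  by (simp add: elog_def)

text \<open>Minimizers depend only on strict comparisons, so \<open>f\<close> and \<open>g\<close>
  may have different codomains, as with \<open>ereal\<close> and \<open>real\<close> below.\<close>

lemma argmin_set_cong:
  assumes "\<And>p q. p \<in> A \<Longrightarrow> q \<in> A \<Longrightarrow> f p < f q \<longleftrightarrow> g p < g q"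
  shows "argmin_set A f = argmin_set A g"
  using assms by (auto simp: argmin_set_def is_arg_min_def)

lemma log_loss_rank_eq:
  fixes M :: "('x, 'n::finite) linear_regressor"
  assumes "0 \<le> \<alpha>" "det (S_mat M \<alpha> x) \<noteq> 0"
  shows "log_loss_rank M \<alpha> x y = ereal (ln (unit_ball_vol (real CARD('n))))
    + (ereal (real CARD('n) / 2) * elog (ennreal (y \<bullet> (S_mat M \<alpha> x *v y)))
       - ereal (1 / 2) * elog (ennreal (det (S_mat M \<alpha> x))))"
proof (cases "y = 0")
  \<comment> \<open>The level is 0 and the dimension is positive, so the volume is 0 and both sides
    are \<open>-\<infinity>\<close>.\<close>
  case True
  with det_S_mat_pos[OF assms] emeasure_loss_level_set[OF assms] show ?thesis
    by (simp add: log_loss_rank_def Loss_eq_inner elog_def)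
next
  case False
  let ?q = "y \<bullet> (S_mat M \<alpha> x *v y)" and ?d = "det (S_mat M \<alpha> x)" and ?n = "CARD('n)"
  have pos: "0 < ?d" "0 < ?q" and c: "0 < unit_ball_vol (real ?n)"
    using det_S_mat_pos[OF assms] S_mat_pos_def[OF assms] False by auto
  have "ln (unit_ball_vol (real ?n) * sqrt ?q ^ ?n / sqrt ?d)
      = ln (unit_ball_vol (real ?n)) + (real ?n / 2 * ln ?q - 1 / 2 * ln ?d)"
    using pos c by (simp add: ln_mult ln_div ln_realpow ln_sqrt less_imp_neq[THEN not_sym])
  moreover have "0 < unit_ball_vol (real ?n) * sqrt ?q ^ ?n / sqrt ?d"
    using pos c by simp
  ultimately show ?thesis
    using pos emeasure_loss_level_set[OF assms, of ?q]
    by (simp add: log_loss_rank_def Loss_eq_inner elog_ennreal)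
qed

theorem theorem10:
  fixes \<M> :: "('x, 'n::finite) linear_regressor set"
    and x :: "'x ^ 'n" and y :: "real ^ 'n"
  shows "(argmin_set (admissible_pairs \<M> x) (\<lambda>(M, \<alpha>). log_loss_rank M \<alpha> x y)
       = argmin_set (admissible_pairs \<M> x)
           (\<lambda>(M, \<alpha>). ereal (real CARD('n) / 2) * elog (ennreal (y \<bullet> (S_mat M \<alpha> x *v y)))
                     - ereal (1 / 2) * elog (ennreal (det (S_mat M \<alpha> x)))))
     \<and> (argmin_set (admissible_pairs \<M> x) (\<lambda>(M, \<alpha>). log_loss_rank M \<alpha> x y)
       = argmin_set (admissible_pairs \<M> x)
           (\<lambda>(M, \<alpha>). (y \<bullet> (S_mat M \<alpha> x *v y)) / det (S_mat M \<alpha> x) powr (1 / real CARD('n))))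
     \<and> (best_regressors \<M> x y
       = fst ` argmin_set (admissible_pairs \<M> x)
           (\<lambda>(M, \<alpha>). (y \<bullet> (S_mat M \<alpha> x *v y)) / det (S_mat M \<alpha> x) powr (1 / real CARD('n))))"
proof -
  let ?A = "admissible_pairs \<M> x" and ?n = "real CARD('n)"
  let ?R = "\<lambda>(M, \<alpha>). log_loss_rank M \<alpha> x y"
  let ?G = "\<lambda>(M, \<alpha>). ereal (?n / 2) * elog (ennreal (y \<bullet> (S_mat M \<alpha> x *v y)))
                     - ereal (1 / 2) * elog (ennreal (det (S_mat M \<alpha> x)))"
  let ?Q = "\<lambda>(M, \<alpha>). (y \<bullet> (S_mat M \<alpha> x *v y)) / det (S_mat M \<alpha> x) powr (1 / ?n)"
  have R: "?R p = ereal (ln (unit_ball_vol ?n)) + ?G p" if "p \<in> ?A" for p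
    using that log_loss_rank_eq by (auto simp: admissible_pairs_def)
  have RG: "argmin_set ?A ?R = argmin_set ?A ?G"
  proof (rule argmin_set_cong)
    \<comment> \<open>Only the added constant must be finite; \<open>a\<close> and \<open>b\<close>
      may be \<open>-\<infinity>\<close>.\<close>
    have "ereal c + a < ereal c + b \<longleftrightarrow> a < b" for a b c
      by (cases a; cases b) simp_all
    then show "?R p < ?R q \<longleftrightarrow> ?G p < ?G q" if "p \<in> ?A" "q \<in> ?A" for p q
      by (simp only: R that)
  qed
  have GQ: "argmin_set ?A ?G = argmin_set ?A ?Q"
  proof (rule argmin_set_cong)
    fix p q assume pq: "p \<in> ?A" "q \<in> ?A"
    show "?G p < ?G q \<longleftrightarrow> ?Q p < ?Q q"
    proof (cases "y = 0")
      case True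
      \<comment> \<open>Treated apart because the real \<open>ln 0\<close> is 0, so
        \<open>?G\<close> is not a multiple of \<open>ln\<close> of \<open>?Q\<close> here; both
        objectives are constant.\<close>
      have *: "?G p = -\<infinity> \<and> ?Q p = 0" if "p \<in> ?A" for p
        using that True by (auto simp: admissible_pairs_def elog_def dest!: det_S_mat_pos)
      show ?thesis
        using *[OF pq(1)] *[OF pq(2)] by (simp only: less_irrefl)
    next
      case False
      have *: "0 < ?Q p \<and> ?G p = ereal (?n / 2 * ln (?Q p))" if "p \<in> ?A" for p
      proof -
        obtain M \<alpha> where p: "p = (M, \<alpha>)"
          by (cases p)
        let ?q = "y \<bullet> (S_mat M \<alpha> x *v y)" and ?d = "det (S_mat M \<alpha> x)"
        have "0 < ?d" "0 < ?q"
          using that False det_S_mat_pos S_mat_pos_def by (auto simp: admissible_pairs_def p)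
        moreover from this have "?n / 2 * ln (?q / ?d powr (1 / ?n)) = ?n / 2 * ln ?q - 1 / 2 * ln ?d"
          by (simp add: ln_div ln_powr field_simps)
        ultimately show ?thesis
          by (simp add: p elog_ennreal)
      qed
      have "0 < ?n / 2"
        by simp
      then show ?thesis
        using *[OF pq(1)] *[OF pq(2)] by (simp only: less_ereal.simps mult_less_cancel_left_pos ln_less_cancel_iff)
    qed
  qed
  have "best_regressors \<M> x y = fst ` argmin_set ?A ?R"
    by (force simp: best_regressors_def)
  with RG GQ show ?thesis
    by simp
qed

end
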